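(* Let $n\ge1$ and let $\sigma$ be a permutation of $\{1,\dots,n\}$. Let $m\ge2$ be an integer and let $w^{(m)}\in\mathcal{W}^{(m)}_+$ be arbitrary. Let $w^{(2)}\in\mathcal{W}^{(2)}$ be the position obtained from $w^{(m)}$ by replacing every non-zero entry $m$ by $2$. Then, in Partizan-Serial-Nim under normal play, $o(w^{(m)})=o(w^{(2)})$.
   Context: Partizan-Serial-Nim: fix an integer $n\ge1$ and a permutation $\sigma$ of $[n]=\{1,\dots,n\}$. Positions are the elements of $\mathcal{W}=\{(w_1,\dots,w_n): w_i\in\mathbb{Z}_{\ge0}\}$; $\mathbf{0}=(0,\dots,0)$ is the only terminal position and $\mathcal{W}_+=\mathcal{W}\setminus\{\mathbf{0}\}$. For $w\in\mathcal{W}_+$, Left's target pile is $l(w)=\min\{i: w_i>0\}$ and Right's target pile $r(w)$ is the index $i$ with $w_i>0$ minimizing $\sigma(i)$. A Left (resp. Right) move from $w$ replaces the entry $w_{l(w)}$ (resp. $w_{r(w)}$) by any strictly smaller non-negative integer. Players alternate and the player who cannot move loses (normal play). Outcomes: $o(w)=\mathcal{L}$ (resp. $\mathcal{R}$) if Left (resp. Right) wins under optimal play no matter who plays first; $o(w)=\mathcal{N}$ if the player moving first wins; $o(w)=\mathcal{P}$ if the player moving second wins. For $m\in\mathbb{Z}_{\ge1}$, $\mathcal{W}^{(m)}=\{w\in\mathcal{W}: w_i\in\{0,m\}\ \forall i\in[n]\}$ and $\mathcal{W}^{(m)}_+=\mathcal{W}^{(m)}\cap\mathcal{W}_+$. 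*)

theory Defs
  imports Main "HOL-Combinatorics.Permutations"
begin

text \<open>
  Partizan-Serial-Nim on \<open>n\<close> piles with a permutation \<open>\<sigma>\<close> of \<open>{1..n}\<close>. A tuple
  \<open>(w_1, ..., w_n)\<close> is a function on \<open>nat\<close> that vanishes outside \<open>{1..n}\<close>, so that
  equality of positions is equality of functions and the terminal position is \<open>\<lambda>_. 0\<close>.
\<close>

type_synonym position = "nat \<Rightarrow> nat"

definition positions :: "nat \<Rightarrow> position set" where
  "positions n = {w. \<forall>i. i \<notin> {1..n} \<longrightarrow> w i = 0}"

definition positions_plus :: "nat \<Rightarrow> position set" where
  "positions_plus n = positions n - {\<lambda>_. 0}"

definition positions_of :: "nat \<Rightarrow> nat \<Rightarrow> position set" where
  "positions_of m n = {w \<in> positions n. \<forall>i\<in>{1..n}. w i \<in> {0, m}}"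

definition positions_of_plus :: "nat \<Rightarrow> nat \<Rightarrow> position set" where
  "positions_of_plus m n = positions_of m n \<inter> positions_plus n"

definition nonempty_piles :: "nat \<Rightarrow> position \<Rightarrow> nat set" where
  "nonempty_piles n w = {i \<in> {1..n}. w i > 0}"

datatype player = Left | Right

fun opponent :: "player \<Rightarrow> player" where
  "opponent Left = Right"
| "opponent Right = Left"

fun target :: "nat \<Rightarrow> (nat \<Rightarrow> nat) \<Rightarrow> player \<Rightarrow> position \<Rightarrow> nat" where
  "target n \<sigma> Left w = Min (nonempty_piles n w)"
| "target n \<sigma> Right w = arg_min_on \<sigma> (nonempty_piles n w)"

text \<open>The targets are meaningful only if some pile is non-empty; otherwise there is no move.\<close>

definition moves :: "nat \<Rightarrow> (nat \<Rightarrow> nat) \<Rightarrow> player \<Rightarrow> position \<Rightarrow> position set" where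
  "moves n \<sigma> p w =
     (if nonempty_piles n w = {} then {}
      else {w(target n \<sigma> p w := k) | k. k < w (target n \<sigma> p w)})"

lemma target_in_nonempty_piles:
  assumes "nonempty_piles n w \<noteq> {}"
  shows "target n \<sigma> p w \<in> nonempty_piles n w"
proof -
  have "finite (nonempty_piles n w)"
    by (simp add: nonempty_piles_def)
  then show ?thesis
    using assms by (cases p) (simp_all add: Min_in arg_min_if_finite(1))
qed

lemma moves_decrease:
  assumes "w' \<in> moves n \<sigma> p w"
  shows "sum w' {1..n} < sum w {1..n}"
proof -
  let ?t = "target n \<sigma> p w"
  from assms have ne: "nonempty_piles n w \<noteq> {}"
    by (auto simp: moves_def)
  with assms obtain k where k: "w' = w(?t := k)" "k < w ?t"
    by (auto simp: moves_def)
  have "?t \<in> {1..n}"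
    using target_in_nonempty_piles[OF ne] by (auto simp: nonempty_piles_def)
  then show ?thesis
    using k by (intro sum_strict_mono_ex1) (auto intro!: bexI[of _ ?t])
qed

text \<open>
  \<open>winner n \<sigma> p w\<close> is the player who wins under optimal play from \<open>w\<close> when \<open>p\<close> moves first:
  \<open>p\<close> wins iff \<open>p\<close> has a move to a position from which, with the opponent to move, \<open>p\<close> wins.
  In particular a player who cannot move loses.
\<close>

function winner :: "nat \<Rightarrow> (nat \<Rightarrow> nat) \<Rightarrow> player \<Rightarrow> position \<Rightarrow> player" where
  "winner n \<sigma> p w =
     (if \<exists>w'\<in>moves n \<sigma> p w. winner n \<sigma> (opponent p) w' = p then p else opponent p)"
  by auto
termination
  by (relation "measure (\<lambda>(n, \<sigma>, p, w). sum w {1..n})") (auto dest: moves_decrease)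

declare winner.simps [simp del]

datatype outcome = \<L> | \<R> | \<N> | \<P>

definition outcome :: "nat \<Rightarrow> (nat \<Rightarrow> nat) \<Rightarrow> position \<Rightarrow> outcome" where
  "outcome n \<sigma> w =
     (case (winner n \<sigma> Left w, winner n \<sigma> Right w) of
        (Left, Left) \<Rightarrow> \<L>
      | (Right, Right) \<Rightarrow> \<R>
      | (Left, Right) \<Rightarrow> \<N>
      | (Right, Left) \<Rightarrow> \<P>)"

definition replace_nonzero :: "nat \<Rightarrow> position \<Rightarrow> position" where
  "replace_nonzero k w = (\<lambda>i. if w i = 0 then 0 else k)"

end

theory Submission
  imports Defs
begin

text \<open>
  Fix a set \<open>S\<close> of piles and let \<open>q\<close> be the player to move when every pile of \<open>S\<close> has size
  \<open>m \<ge> 2\<close>, except that the pile \<open>q\<close> is working on may already have been reduced to some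
  \<open>v \<in> {1..m}\<close>. The key fact is that the set of those \<open>v\<close> for which \<open>q\<close> loses is cut out by one
  of \<open>UNIV\<close>, \<open>{1}\<close>, \<open>{}\<close>, and that \<open>S\<close> and the order of the piles decide which one,
  independently of \<open>m\<close> (\<open>first_wins_iff\<close>). At \<open>v = m \<ge> 2\<close> this says that the outcome
  of the position with all piles of \<open>S\<close> of size \<open>m\<close> does not depend on \<open>m\<close>.

  The induction is on the number of piles. A target pile stays the target until it is gone, so play
  only leaves \<open>S\<close> when a target pile is emptied, and what happens then is described by the
  induction hypothesis for \<open>S\<close> without that pile. Up to that moment there are two cases.

  If both players work on the same pile, the only resource besides emptying it is to leave a single
  token. The opponent then has to take that token, and this wins unless the opponent profits from
  having emptied the pile (\<open>shared_pile_race\<close>).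

  If they work on different piles of sizes \<open>a\<close> and \<open>b\<close>, a mover who wins by emptying the pile does
  so. If this is not possible and the opponent does not always win by emptying the other pile,
  the mover wins exactly when ahead, by equalising the two piles: whoever faces equal piles falls
  behind with any move that does not empty a pile (\<open>separate_pile_race\<close>). No pile exceeds \<open>m\<close>, so
  a mover whose opponent has an untouched pile is never ahead and can only win by emptying. Hence
  the size of the mover's own pile does not matter in this case.
\<close>

section \<open>Target piles of a set of piles\<close>

fun target_of :: "(nat \<Rightarrow> nat) \<Rightarrow> player \<Rightarrow> nat set \<Rightarrow> nat" where
  "target_of \<sigma> Left S = Min S"
| "target_of \<sigma> Right S = arg_min_on \<sigma> S"

lemma target_eq_target_of: "target n \<sigma> p w = target_of \<sigma> p (nonempty_piles n w)"
  by (cases p) simp_all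

lemma target_of_mem:
  assumes "finite S" "S \<noteq> {}"
  shows "target_of \<sigma> p S \<in> S"
  using assms by (cases p) (simp_all add: arg_min_if_finite(1))

lemma target_of_subset:
  assumes "finite S" "inj_on \<sigma> S" "S' \<subseteq> S" "target_of \<sigma> p S \<in> S'"
  shows "target_of \<sigma> p S' = target_of \<sigma> p S"
proof (cases p)
  case Left
  have "Min S' = Min S"
  proof (rule Min_eqI)
    show "finite S'"
      using assms(3,1) by (rule finite_subset)
    show "Min S \<le> x" if "x \<in> S'" for x
      using assms(1,3) that by (simp add: subset_iff)
    show "Min S \<in> S'"
      using assms(4) Left by simp
  qed
  then show ?thesis
    using Left by simp
next
  case Right
  let ?t = "arg_min_on \<sigma> S" and ?t' = "arg_min_on \<sigma> S'"
  have fin: "finite S'"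
    using assms(3,1) by (rule finite_subset)
  have t: "?t \<in> S'"
    using assms(4) Right by simp
  have t': "?t' \<in> S'"
    using arg_min_if_finite(1)[OF fin] t by blast
  have "\<sigma> ?t' \<le> \<sigma> ?t"
    using arg_min_least[OF fin _ t] t by blast
  moreover have "\<sigma> ?t \<le> \<sigma> ?t'"
    using arg_min_least[OF assms(1), of ?t'] assms(3) t' by blast
  ultimately have "\<sigma> ?t' = \<sigma> ?t"
    by simp
  then have "?t' = ?t"
    using inj_onD[OF assms(2)] assms(3) t t' by blast
  then show ?thesis
    using Right by simp
qed

lemma opponent_opponent [simp]: "opponent (opponent p) = p"
  by (cases p) simp_all

lemma opponent_neq [simp]: "opponent p \<noteq> p"
  by (cases p) simp_all

section \<open>Winning as the first player\<close>

abbreviation first_wins :: "nat \<Rightarrow> (nat \<Rightarrow> nat) \<Rightarrow> player \<Rightarrow> position \<Rightarrow> bool" where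
  "first_wins n \<sigma> p w \<equiv> winner n \<sigma> p w = p"

lemma winner_eq_opponent_iff: "winner n \<sigma> p w = opponent p \<longleftrightarrow> \<not> first_wins n \<sigma> p w"
  by (cases p; cases "winner n \<sigma> p w") auto

lemma first_wins_step:
  "first_wins n \<sigma> p w \<longleftrightarrow> (\<exists>w'\<in>moves n \<sigma> p w. \<not> first_wins n \<sigma> (opponent p) w')"
  by (subst winner.simps) (use winner_eq_opponent_iff[of n \<sigma> "opponent p"] in simp)

text \<open>
  Reducing the target pile to \<open>0\<close> changes the set of piles in play and is split off from the
  other moves, which keep it.
\<close>

lemma first_wins_iff_move:
  assumes "nonempty_piles n w = S" "S \<noteq> {}" "t = target_of \<sigma> p S"
  shows "first_wins n \<sigma> p w \<longleftrightarrow>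
    \<not> first_wins n \<sigma> (opponent p) (w(t := 0)) \<or>
    (\<exists>k\<in>{1..<w t}. \<not> first_wins n \<sigma> (opponent p) (w(t := k)))"
proof -
  have t: "target n \<sigma> p w = t"
    using assms by (simp add: target_eq_target_of)
  have "t \<in> nonempty_piles n w"
    using target_in_nonempty_piles[of n w \<sigma> p] assms(1,2) t by simp
  then have "w t > 0"
    by (simp add: nonempty_piles_def)
  then have "{..<w t} = insert 0 {1..<w t}"
    by auto
  moreover have "moves n \<sigma> p w = (\<lambda>k. w(t := k)) ` {..<w t}"
    using assms t by (auto simp: moves_def)
  ultimately show ?thesis
    by (subst first_wins_step) auto
qed

section \<open>The two races\<close>

text \<open>
  \<open>A a b\<close> and \<open>B a b\<close> say that the owner of the pile of size \<open>a\<close>, respectively \<open>b\<close>, wins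
  moving first. Emptying the pile of size \<open>a\<close> wins iff the remaining pile has a size \<open>b \<in> X\<close>, and
  symmetrically for \<open>Y\<close>. A mover who is ahead equalises; this fails only against an opponent who
  then wins by emptying a pile. If \<open>Y \<noteq> UNIV\<close>, that can only happen at \<open>(1, 1)\<close> with \<open>Y = {1}\<close>. The
  last assumptions ensure that the mover then has \<open>1 \<in> X\<close> and wins by emptying the pile at once.
\<close>

lemma separate_pile_race:
  fixes A B :: "nat \<Rightarrow> nat \<Rightarrow> bool"
  assumes A: "\<And>a b. a \<in> {1..m} \<Longrightarrow> b \<in> {1..m} \<Longrightarrow>
                A a b \<longleftrightarrow> b \<in> X \<or> (\<exists>a'\<in>{1..<a}. \<not> B a' b)"
    and B: "\<And>a b. a \<in> {1..m} \<Longrightarrow> b \<in> {1..m} \<Longrightarrow>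
                B a b \<longleftrightarrow> a \<in> Y \<or> (\<exists>b'\<in>{1..<b}. \<not> A a b')"
    and X: "X \<in> {UNIV, {1}, {}}" and Y: "Y \<in> {UNIV, {1}, {}}"
    and XY: "X = {1} \<Longrightarrow> Y \<noteq> {}" "Y = {1} \<Longrightarrow> X \<noteq> {}"
    and "a \<in> {1..m}" "b \<in> {1..m}"
  shows "(A a b \<longleftrightarrow> b \<in> X \<or> Y \<noteq> UNIV \<and> b < a) \<and>
         (B a b \<longleftrightarrow> a \<in> Y \<or> X \<noteq> UNIV \<and> a < b)"
  using assms(7,8)
proof (induction "a + b" arbitrary: a b rule: less_induct)
  case less
  \<comment> \<open>In both races the equalising move witnesses the existential quantifier.\<close>
  have "(\<exists>a'\<in>{1..<a}. \<not> B a' b) \<longleftrightarrow> (\<exists>a'\<in>{1..<a}. a' \<notin> Y \<and> (X = UNIV \<or> b \<le> a'))"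
    using less by (intro bex_cong) auto
  moreover have "\<dots> \<longleftrightarrow> Y \<noteq> UNIV \<and> b < a" if "b \<notin> X"
    using that X Y XY less.prems by (auto intro: bexI[of _ b])
  moreover have "(\<exists>b'\<in>{1..<b}. \<not> A a b') \<longleftrightarrow> (\<exists>b'\<in>{1..<b}. b' \<notin> X \<and> (Y = UNIV \<or> a \<le> b'))"
    using less by (intro bex_cong) auto
  moreover have "\<dots> \<longleftrightarrow> X \<noteq> UNIV \<and> a < b" if "a \<notin> Y"
    using that X Y XY less.prems by (auto intro: bexI[of _ a])
  ultimately show ?case
    using A[OF less.prems] B[OF less.prems] by blast
qed

text \<open>
  Here \<open>X\<close> and \<open>Y\<close> say that emptying the shared pile wins for the respective player. If neither
  does, whoever faces a single token has to take it and loses, so a mover who has more than one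
  token leaves exactly one.
\<close>

lemma shared_pile_race:
  fixes A B :: "nat \<Rightarrow> bool"
  assumes A: "\<And>v. v \<in> {1..m} \<Longrightarrow> A v \<longleftrightarrow> X \<or> (\<exists>k\<in>{1..<v}. \<not> B k)"
    and B: "\<And>v. v \<in> {1..m} \<Longrightarrow> B v \<longleftrightarrow> Y \<or> (\<exists>k\<in>{1..<v}. \<not> A k)"
    and v: "v \<in> {1..m}"
  shows "A v \<longleftrightarrow> X \<or> 1 < v \<and> \<not> Y"
proof (cases "1 < v")
  case True
  have one: "(1::nat) \<in> {1..m}"
    using v by simp
  have B1: "B 1 \<longleftrightarrow> Y" and A1: "A 1 \<longleftrightarrow> X"
    using A[OF one] B[OF one] by auto
  have "\<not> X \<Longrightarrow> Y \<Longrightarrow> B k" if "k \<in> {1..<v}" for k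
    using B[of k] that v by auto
  then show ?thesis
    using A[OF v] True B1 by (auto intro: bexI[of _ 1])
next
  case False
  then show ?thesis
    using A[OF v] by auto
qed

section \<open>The sizes at which the player to move loses\<close>

text \<open>
  The sizes of the mover's own target pile at which the mover \<open>q\<close> loses, when the other piles of
  \<open>S\<close> have a common size \<open>m \<ge> 2\<close>. The value \<open>UNIV\<close> means that \<open>q\<close> loses at every size up to
  \<open>m\<close>; it is also the right value when there are no piles, because then \<open>q\<close> cannot move.

  The value is \<open>{}\<close> if \<open>q\<close> wins by emptying the target pile. Otherwise a shared pile still lets \<open>q\<close>
  win by leaving a single token, provided that there are more to begin with and that the opponent
  does not win by taking the last one; this gives \<open>{1}\<close>. In a race between different piles, \<open>q\<close> is
  never ahead of an untouched pile of the opponent, which gives \<open>UNIV\<close>.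
\<close>

function losing_sizes :: "(nat \<Rightarrow> nat) \<Rightarrow> player \<Rightarrow> nat set \<Rightarrow> nat set" where
  "losing_sizes \<sigma> q S =
     (if infinite S \<or> S = {} then UNIV
      else if losing_sizes \<sigma> (opponent q) (S - {target_of \<sigma> q S}) = UNIV then {}
      else if target_of \<sigma> (opponent q) S = target_of \<sigma> q S \<and>
              losing_sizes \<sigma> q (S - {target_of \<sigma> q S}) \<noteq> UNIV then {1}
      else UNIV)"
  by auto
termination
  by (relation "measure (\<lambda>(\<sigma>, q, S). card S)")
    (simp_all add: target_of_mem card_gt_0_iff)

declare losing_sizes.simps [simp del]

lemma losing_sizes_step:
  assumes "finite S" "S \<noteq> {}" "t = target_of \<sigma> q S" "p = opponent q"
  shows "losing_sizes \<sigma> q S =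
    (if losing_sizes \<sigma> p (S - {t}) = UNIV then {}
     else if target_of \<sigma> p S = t \<and> losing_sizes \<sigma> q (S - {t}) \<noteq> UNIV then {1}
     else UNIV)"
  using assms by (subst losing_sizes.simps) (simp only: simp_thms if_False)

lemma losing_sizes_cases: "losing_sizes \<sigma> q S \<in> {UNIV, {1}, {}}"
  by (subst losing_sizes.simps) simp

lemma singleton_neq_UNIV: "{a} \<noteq> (UNIV :: nat set)"
  using infinite_UNIV_nat by (metis finite.emptyI finite.insertI)

lemma mem_losing_sizes_iff_UNIV:
  assumes "m \<ge> 2"
  shows "m \<in> losing_sizes \<sigma> q S \<longleftrightarrow> losing_sizes \<sigma> q S = UNIV"
proof -
  have "losing_sizes \<sigma> q S = UNIV \<or> losing_sizes \<sigma> q S = {1} \<or> losing_sizes \<sigma> q S = {}"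
    using losing_sizes_cases[of \<sigma> q S] by blast
  then show ?thesis
  proof (elim disjE)
    assume "losing_sizes \<sigma> q S = {1}"
    then show ?thesis
      using assms singleton_neq_UNIV by simp
  qed simp_all
qed

text \<open>
  This is the compatibility assumption of \<open>separate_pile_race\<close>. Let \<open>q\<close> be the opponent of \<open>p\<close>. The
  value \<open>{1}\<close> only arises for a shared pile after whose removal the player to move wins, whoever this
  is. So \<open>q\<close> wins moving first once both target piles are gone. If instead \<open>q\<close> has emptied a pile and
  left \<open>p\<close> with a single token in the other one, \<open>p\<close> must empty that too, hand the move to \<open>q\<close>, and lose.
\<close>

lemma losing_sizes_compatible:
  assumes "finite S" "inj_on \<sigma> S" "S \<noteq> {}"
    and neq: "target_of \<sigma> p S \<noteq> target_of \<sigma> (opponent p) S"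
    and one: "losing_sizes \<sigma> (opponent p) (S - {target_of \<sigma> p S}) = {1}"
  shows "losing_sizes \<sigma> p (S - {target_of \<sigma> (opponent p) S}) \<noteq> {}"
proof -
  let ?q = "opponent p"
  let ?tp = "target_of \<sigma> p S" and ?tq = "target_of \<sigma> ?q S"
  let ?Sp = "S - {?tp}" and ?Sq = "S - {?tq}"
  have mem: "?tp \<in> S" "?tq \<in> S"
    using assms(1,3) by (simp_all add: target_of_mem)
  have tq: "target_of \<sigma> ?q ?Sp = ?tq" and tp: "target_of \<sigma> p ?Sq = ?tp"
    by (rule target_of_subset[OF assms(1,2)]; use mem neq in simp)+
  have swap: "?Sp - {?tq} = ?Sq - {?tp}"
    by blast
  have "?tq \<in> ?Sp" "?tp \<in> ?Sq"
    using mem neq by simp_all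
  then have "?Sp \<noteq> {}" "?Sq \<noteq> {}"
    by (metis empty_iff)+
  have "losing_sizes \<sigma> ?q (?Sp - {?tq}) \<noteq> UNIV"
  proof
    assume *: "losing_sizes \<sigma> ?q (?Sp - {?tq}) = UNIV"
    have "losing_sizes \<sigma> ?q ?Sp \<in> {UNIV, {}}"
      unfolding losing_sizes_step[OF finite_Diff[OF assms(1)] \<open>?Sp \<noteq> {}\<close> tq[symmetric] refl] *
      by simp
    then show False
      unfolding one using singleton_neq_UNIV[of 1] by simp
  qed
  then show ?thesis
    unfolding losing_sizes_step[OF finite_Diff[OF assms(1)] \<open>?Sq \<noteq> {}\<close> tp[symmetric] refl] swap
    by simp
qed

section \<open>Positions with piles of a common size\<close>

definition uniform :: "nat \<Rightarrow> nat set \<Rightarrow> position" where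
  "uniform m S = (\<lambda>i. if i \<in> S then m else 0)"

lemma uniform_upd_zero: "(uniform m S)(i := 0) = uniform m (S - {i})"
  by (auto simp: uniform_def)

lemma uniform_upd_same: "i \<in> S \<Longrightarrow> (uniform m S)(i := m) = uniform m S"
  by (auto simp: uniform_def)

lemma nonempty_piles_uniform_upd:
  assumes "S \<subseteq> {1..n}" "i \<in> S" "j \<in> S" "a > 0" "b > 0" "m > 0"
  shows "nonempty_piles n ((uniform m S)(i := a, j := b)) = S"
  using assms by (auto simp: nonempty_piles_def uniform_def)

lemma first_wins_iff:
  assumes "S \<subseteq> {1..n}" "inj_on \<sigma> S" "m \<ge> 2" "S \<noteq> {}" "v \<in> {1..m}"
  shows "first_wins n \<sigma> q ((uniform m S)(target_of \<sigma> q S := v)) \<longleftrightarrow> v \<notin> losing_sizes \<sigma> q S"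
  using assms
proof (induction "card S" arbitrary: S q v rule: less_induct)
  case less
  define p where "p = opponent q"
  have opp: "opponent q = p" "opponent p = q"
    by (simp_all add: p_def)
  have fin: "finite S"
    using less.prems(1) by (rule finite_subset) simp
  define tp where "tp = target_of \<sigma> p S"
  define tq where "tq = target_of \<sigma> q S"
  have mem: "tp \<in> S" "tq \<in> S"
    using fin less.prems(4) by (simp_all add: tp_def tq_def target_of_mem)
  have IH: "first_wins n \<sigma> r ((uniform m (S - {i}))(target_of \<sigma> r (S - {i}) := u)) \<longleftrightarrow>
      u \<notin> losing_sizes \<sigma> r (S - {i})"
    if "i \<in> S" "S - {i} \<noteq> {}" "u \<in> {1..m}" for r i u
  proof (rule less.hyps)
    show "card (S - {i}) < card S"
      using fin that(1) by (rule card_Diff1_less)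
    show "S - {i} \<subseteq> {1..n}"
      using less.prems(1) by blast
    show "inj_on \<sigma> (S - {i})"
      using less.prems(2) by (rule inj_on_diff)
  qed (fact less.prems(3) that)+
  show ?case
  proof (cases "tp = tq")
    case True
    let ?T = "S - {tq}"
    have full: "first_wins n \<sigma> r (uniform m ?T) \<longleftrightarrow> losing_sizes \<sigma> r ?T \<noteq> UNIV" for r
    proof (cases "?T = {}")
      case True
      have "moves n \<sigma> r (uniform m {}) = {}"
        by (simp add: moves_def nonempty_piles_def uniform_def)
      then show ?thesis
        unfolding True by (subst first_wins_step, subst losing_sizes.simps) simp
    next
      case False
      have "target_of \<sigma> r ?T \<in> ?T"
        by (rule target_of_mem[OF finite_Diff[OF fin] False])
      then show ?thesis
        using IH[OF mem(2) False, of m r] less.prems(3) mem_losing_sizes_iff_UNIV[of m \<sigma> r ?T]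
        by (simp add: uniform_upd_same del: Diff_iff)
    qed
    have step: "first_wins n \<sigma> r ((uniform m S)(tq := u)) \<longleftrightarrow>
        losing_sizes \<sigma> (opponent r) ?T = UNIV \<or>
        (\<exists>k\<in>{1..<u}. \<not> first_wins n \<sigma> (opponent r) ((uniform m S)(tq := k)))"
      if "u \<in> {1..m}" "r \<in> {p, q}" for r u
    proof -
      have "nonempty_piles n ((uniform m S)(tq := u)) = S"
        using nonempty_piles_uniform_upd[OF less.prems(1) mem(2,2), of u u m] that by simp
      moreover have "tq = target_of \<sigma> r S"
        using that True by (auto simp: tp_def tq_def)
      ultimately show ?thesis
        using full by (subst first_wins_iff_move) (auto simp: less.prems(4) uniform_upd_zero)
    qed
    have "first_wins n \<sigma> q ((uniform m S)(tq := v)) \<longleftrightarrow>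
        losing_sizes \<sigma> p ?T = UNIV \<or> 1 < v \<and> losing_sizes \<sigma> q ?T \<noteq> UNIV"
      by (rule shared_pile_race[where m = m
            and B = "\<lambda>u. first_wins n \<sigma> p ((uniform m S)(tq := u))"])
        (fact step[of _ q, unfolded opp, OF _ insertI2[OF insertI1]]
          step[of _ p, unfolded opp, OF _ insertI1] less.prems(5))+
    also have "\<dots> \<longleftrightarrow> v \<notin> losing_sizes \<sigma> q S"
      unfolding losing_sizes_step[OF fin less.prems(4) tq_def p_def]
      using True less.prems(5) by (auto simp flip: tp_def)
    finally show ?thesis
      by (simp add: tq_def)
  next
    case False
    define X where "X = losing_sizes \<sigma> p (S - {tq})"
    define Y where "Y = losing_sizes \<sigma> q (S - {tp})"
    let ?w = "\<lambda>a b. (uniform m S)(tq := a, tp := b)"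
    have tp: "target_of \<sigma> p (S - {tq}) = tp" and tq: "target_of \<sigma> q (S - {tp}) = tq"
      unfolding tp_def tq_def
      by (rule target_of_subset[OF fin less.prems(2)]; use mem False in \<open>simp add: tp_def tq_def\<close>)+
    have "tp \<in> S - {tq}" "tq \<in> S - {tp}"
      using mem False by simp_all
    then have ne: "S - {tq} \<noteq> {}" "S - {tp} \<noteq> {}"
      by (metis empty_iff)+
    have piles: "nonempty_piles n (?w a b) = S" if "a \<in> {1..m}" "b \<in> {1..m}" for a b
      using nonempty_piles_uniform_upd[OF less.prems(1) mem(2,1)] that by simp
    have empty_q: "(?w a b)(tq := 0) = (uniform m (S - {tq}))(tp := b)" for a b
      using False by (auto simp: uniform_def)
    have empty_p: "(?w a b)(tp := 0) = (uniform m (S - {tp}))(tq := a)" for a b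
      using False by (auto simp: uniform_def)
    have reduce_q: "(?w a b)(tq := k) = ?w k b" for a b k
      using False by auto
    have step_q: "first_wins n \<sigma> q (?w a b) \<longleftrightarrow>
        b \<in> X \<or> (\<exists>a'\<in>{1..<a}. \<not> first_wins n \<sigma> p (?w a' b))"
      if "a \<in> {1..m}" "b \<in> {1..m}" for a b
    proof -
      have "first_wins n \<sigma> p ((?w a b)(tq := 0)) \<longleftrightarrow> b \<notin> X"
        using IH[OF mem(2) ne(1) that(2), of p] unfolding X_def empty_q tp .
      moreover have "(?w a b) tq = a"
        using False by simp
      ultimately show ?thesis
        using first_wins_iff_move[OF piles[OF that] less.prems(4) tq_def] opp
        by (simp only: reduce_q) simp
    qed
    have step_p: "first_wins n \<sigma> p (?w a b) \<longleftrightarrow>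
        a \<in> Y \<or> (\<exists>b'\<in>{1..<b}. \<not> first_wins n \<sigma> q (?w a b'))"
      if "a \<in> {1..m}" "b \<in> {1..m}" for a b
    proof -
      have "first_wins n \<sigma> q ((?w a b)(tp := 0)) \<longleftrightarrow> a \<notin> Y"
        using IH[OF mem(1) ne(2) that(1), of q] unfolding Y_def empty_p tq .
      then show ?thesis
        using first_wins_iff_move[OF piles[OF that] less.prems(4) tp_def] opp
        by simp
    qed
    have XY: "X = {1} \<Longrightarrow> Y \<noteq> {}" "Y = {1} \<Longrightarrow> X \<noteq> {}"
      using losing_sizes_compatible[OF fin less.prems(2,4), of q]
        losing_sizes_compatible[OF fin less.prems(2,4), of p] False opp
      by (auto simp: X_def Y_def tp_def tq_def)
    have untouched: "?w v m = (uniform m S)(tq := v)"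
      using False mem by (auto simp: uniform_def)
    have m: "m \<in> {1..m}"
      using less.prems(3) by simp
    have "first_wins n \<sigma> q (?w v m) \<longleftrightarrow> m \<in> X \<or> Y \<noteq> UNIV \<and> m < v"
      using separate_pile_race[where A = "\<lambda>a b. first_wins n \<sigma> q (?w a b)"
          and B = "\<lambda>a b. first_wins n \<sigma> p (?w a b)" and X = X and Y = Y and m = m,
          OF step_q step_p _ _ XY less.prems(5) m] losing_sizes_cases
      by (simp add: X_def Y_def)
    \<comment> \<open>The pile of \<open>p\<close> is untouched, so \<open>q\<close> is never ahead and can only win by emptying a pile.\<close>
    also have "\<dots> \<longleftrightarrow> X = UNIV"
      using less.prems(3,5) mem_losing_sizes_iff_UNIV by (auto simp: X_def)
    also have "\<dots> \<longleftrightarrow> v \<notin> losing_sizes \<sigma> q S"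
      unfolding losing_sizes_step[OF fin less.prems(4) tq_def p_def] X_def
      using False by (simp flip: tp_def)
    finally show ?thesis
      unfolding untouched unfolding tq_def .
  qed
qed

lemma winner_uniform_eq:
  assumes "S \<subseteq> {1..n}" "inj_on \<sigma> S" "m \<ge> 2" "m' \<ge> 2" "S \<noteq> {}"
  shows "winner n \<sigma> q (uniform m S) = winner n \<sigma> q (uniform m' S)"
proof -
  have "first_wins n \<sigma> q (uniform k S) \<longleftrightarrow> losing_sizes \<sigma> q S \<noteq> UNIV" if "k \<ge> 2" for k
  proof -
    have "target_of \<sigma> q S \<in> S"
      using finite_subset[OF assms(1)] assms(5) by (simp add: target_of_mem)
    then show ?thesis
      using first_wins_iff[OF assms(1,2) that assms(5), of k q] that
        mem_losing_sizes_iff_UNIV[OF that, of \<sigma> q S]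
      by (simp add: uniform_upd_same)
  qed
  then show ?thesis
    using assms(3,4) winner_eq_opponent_iff by metis
qed

theorem corollary4p3:
  fixes n m :: nat and \<sigma> :: "nat \<Rightarrow> nat" and w :: position
  assumes "n \<ge> 1"
    and "\<sigma> permutes {1..n}"
    and "m \<ge> 2"
    and "w \<in> positions_of_plus m n"
  shows "outcome n \<sigma> w = outcome n \<sigma> (replace_nonzero 2 w)"
proof -
  define S where "S = nonempty_piles n w"
  have w: "i \<notin> {1..n} \<Longrightarrow> w i = 0" "i \<in> {1..n} \<Longrightarrow> w i \<in> {0, m}" for i
    using assms(4) by (auto simp: positions_of_plus_def positions_of_def positions_def)
  have "w \<noteq> (\<lambda>_. 0)"
    using assms(4) by (simp add: positions_of_plus_def positions_plus_def)
  then obtain i where "w i \<noteq> 0"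
    by (auto simp: fun_eq_iff)
  then have "i \<in> S"
    using w(1)[of i] by (auto simp: S_def nonempty_piles_def)
  then have "S \<noteq> {}"
    by blast
  have "w = uniform m S" "replace_nonzero 2 w = uniform 2 S"
    using w by (fastforce simp: S_def nonempty_piles_def uniform_def replace_nonzero_def)+
  moreover have "winner n \<sigma> q (uniform m S) = winner n \<sigma> q (uniform 2 S)" for q
  proof (rule winner_uniform_eq)
    show "S \<subseteq> {1..n}"
      by (auto simp: S_def nonempty_piles_def)
    show "inj_on \<sigma> S"
      using permutes_inj[OF assms(2)] by (rule inj_on_subset) simp
  qed (use assms(3) \<open>S \<noteq> {}\<close> in simp_all)
  ultimately show ?thesis
    by (simp add: outcome_def)
qed

end
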